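(* Fix a feedback matrix $\bar G$ that is strictly block lower triangular (see context). Let $\eta_1,\dots,\eta_r:\mathbb{R}^{(N+1)n+Nm}\to\mathbb{R}$ be measurable and, for $i=1,\dots,r$, $\bar d\in\mathbb{R}^{Nm}$ and $\bar w\in\mathbb{R}^{Nn}$, define $$g_i(\bar d,\bar w)=\eta_i\big(\bar A x_0+\bar B(\bar G\bar w+\bar d)+\bar D\bar w,\ \bar G\bar w+\bar d\big).$$ Assume that the random vector $\bar w$ has a continuous distribution with log-concave probability density and that, for $i=1,\dots,r$, $g_i:\mathbb{R}^{Nm+Nn}\to\mathbb{R}$ is quasi-convex. Let $p(\bar d)=\mathbb{P}[g_1(\bar d,\bar w)\le 0,\dots,g_r(\bar d,\bar w)\le 0]$. Then, for any $\alpha\in\,]0,1[$, the set $\mathcal{F}_{CC}=\{\bar d\in\mathbb{R}^{Nm}:\ p(\bar d)\ge 1-\alpha\}$ is convex. As a consequence, if $V:\mathbb{R}^{(N+1)n}\times\mathbb{R}^{Nm}\to\mathbb{R}$ is measurable and convex and $\mathbb{E}[V(\bar x_\theta,\bar u_\theta)]$ is finite for all $\theta\in\Theta=\{(\bar G,\bar d):\bar d\in\mathbb{R}^{Nm}\}$, then for any $\alpha\in\,]0,1[$ the optimization problem $$\inf_{\theta\in\Theta}\ \mathbb{E}[V(\bar x_\theta,\bar u_\theta)]\quad\text{subject to}\quad p(\bar d)\ge 1-\alpha$$ is convex.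
   Context: Let $n,m,N,r\ge 1$ be integers, $A\in\mathbb{R}^{n\times n}$, $B\in\mathbb{R}^{n\times m}$, $x_0\in\mathbb{R}^n$, and let $w(0),\dots,w(N-1)$ be $\mathbb{R}^n$-valued random vectors on a probability space $(\Omega,\mathfrak{F},\mathbb{P})$, stacked into $\bar w\in\mathbb{R}^{Nn}$. The linear system $x(t+1)=Ax(t)+Bu(t)+w(t)$, $x(0)=x_0$, is written over $t=0,\dots,N$ as $\bar x=\bar A x_0+\bar B\bar u+\bar D\bar w$, where $\bar x\in\mathbb{R}^{(N+1)n}$ stacks $x(0),\dots,x(N)$ and $\bar u\in\mathbb{R}^{Nm}$ stacks $u(0),\dots,u(N-1)$; $\bar A$ stacks $I_n,A,\dots,A^N$; $\bar B$ is the $(N+1)n\times Nm$ matrix whose $n\times m$ block in position $(t,s)$, $0\le t\le N$, $0\le s\le N-1$, is $A^{t-1-s}B$ if $s<t$ and $0$ otherwise; $\bar D$ is the $(N+1)n\times Nn$ matrix whose $n\times n$ block $(t,s)$ is $A^{t-1-s}$ if $s<t$ and $0$ otherwise. A matrix $\bar G\in\mathbb{R}^{Nm\times Nn}$ is strictly block lower triangular if its $m\times n$ block $(t,i)$, $0\le t,i\le N-1$, vanishes whenever $i\ge t$. For $\theta=(\bar G,\bar d)$, $\bar u_\theta=\bar G\bar w+\bar d$ and $\bar x_\theta=\bar A x_0+\bar B(\bar G\bar w+\bar d)+\bar D\bar w$. A nonnegative function $f$ is log-concave if $f(\lambda x+(1-\lambda)y)\ge f(x)^\lambda f(y)^{1-\lambda}$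 for all $x,y$ and $\lambda\in\,]0,1[$. A function is quasi-convex if all its sublevel sets are convex (here jointly in $(\bar d,\bar w)$). An optimization problem is convex if its objective is a convex function of the decision variable and its feasible set is convex. *)

theory Defs
  imports "HOL-Probability.Probability"
begin

(* A horizon of length N is given by a finite type 'N with CARD('N) = N.  Inputs and
   disturbances are indexed by 'N stage = {0,...,N-1}, states by 'N epoch = {0,...,N}.
   The morphisms into nat recover the actual time instant. *)

typedef 'N stage = "{..<CARD('N::finite)}"
  morphisms stage_time Stage
  by (auto intro!: exI[of _ 0])

typedef 'N epoch = "{..CARD('N::finite)}"
  morphisms epoch_time Epoch
  by auto

lemma range_stage_time: "range (stage_time :: 'N::finite stage \<Rightarrow> nat) = {..<CARD('N)}"
  by (rule type_definition.Rep_range[OF type_definition_stage])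

lemma range_epoch_time: "range (epoch_time :: 'N::finite epoch \<Rightarrow> nat) = {..CARD('N)}"
  by (rule type_definition.Rep_range[OF type_definition_epoch])

instance stage :: (finite) finite
  by standard (metis finite_imageD finite_lessThan inj_onI range_stage_time stage_time_inject)

instance epoch :: (finite) finite
  by standard (metis finite_imageD finite_atMost inj_onI range_epoch_time epoch_time_inject)

lemma card_stage: "CARD('N::finite stage) = CARD('N)"
  by (metis card_image card_lessThan inj_onI range_stage_time stage_time_inject)

lemma card_epoch: "CARD('N::finite epoch) = CARD('N) + 1"
  by (metis Suc_eq_plus1 card_atMost card_image inj_onI range_epoch_time epoch_time_inject)

(* Multiplication, and hence (^), on type vec is componentwise; this is the matrix power. *)

primrec mat_pow :: "real^'n^'n \<Rightarrow> nat \<Rightarrow> real^'n^'n" where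
  "mat_pow A 0 = mat 1"
| "mat_pow A (Suc k) = A ** mat_pow A k"

definition stack_vec :: "('t::finite \<Rightarrow> real^'a) \<Rightarrow> real^('t \<times> 'a)" where
  "stack_vec v = (\<chi> p. v (fst p) $ snd p)"

definition block_matrix ::
    "('t::finite \<Rightarrow> 's::finite \<Rightarrow> real^'b^'a) \<Rightarrow> real^('s \<times> 'b::finite)^('t \<times> 'a::finite)" where
  "block_matrix F = (\<chi> p q. F (fst p) (fst q) $ snd p $ snd q)"

definition block :: "real^('s \<times> 'b::finite)^('t \<times> 'a::finite) \<Rightarrow> 't::finite \<Rightarrow> 's::finite \<Rightarrow> real^'b^'a" where
  "block M t s = (\<chi> a b. M $ (t, a) $ (s, b))"

definition A_bar :: "real^'n^'n \<Rightarrow> real^'n^('N::finite epoch \<times> 'n)" where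
  "A_bar A = (\<chi> p. mat_pow A (epoch_time (fst p)) $ snd p)"

definition B_bar :: "real^'n^'n \<Rightarrow> real^'m^'n \<Rightarrow> real^('N::finite stage \<times> 'm)^('N epoch \<times> 'n)" where
  "B_bar A B = block_matrix (\<lambda>t s.
     if stage_time s < epoch_time t then mat_pow A (epoch_time t - 1 - stage_time s) ** B else 0)"

definition D_bar :: "real^'n^'n \<Rightarrow> real^('N::finite stage \<times> 'n)^('N epoch \<times> 'n)" where
  "D_bar A = block_matrix (\<lambda>t s.
     if stage_time s < epoch_time t then mat_pow A (epoch_time t - 1 - stage_time s) else 0)"

definition strictly_block_lower_triangular ::
    "real^('N::finite stage \<times> 'n::finite)^('N stage \<times> 'm::finite) \<Rightarrow> bool" where
  "strictly_block_lower_triangular G \<longleftrightarrow>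
     (\<forall>t i. stage_time i \<ge> stage_time t \<longrightarrow> block G t i = 0)"

definition input_traj ::
    "(real^('N::finite stage \<times> 'n::finite)^('N stage \<times> 'm::finite)) \<times> (real^('N stage \<times> 'm))
     \<Rightarrow> real^('N stage \<times> 'n) \<Rightarrow> real^('N stage \<times> 'm)" where
  "input_traj \<theta> w = fst \<theta> *v w + snd \<theta>"

definition state_traj ::
    "real^'n^'n \<Rightarrow> real^'m^'n \<Rightarrow> real^'n
     \<Rightarrow> (real^('N::finite stage \<times> 'n)^('N stage \<times> 'm)) \<times> (real^('N stage \<times> 'm))
     \<Rightarrow> real^('N stage \<times> 'n) \<Rightarrow> real^('N epoch \<times> 'n)" where
  "state_traj A B x0 \<theta> w = A_bar A *v x0 + B_bar A B *v (fst \<theta> *v w + snd \<theta>) + D_bar A *v w"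

(* f x powr l is 0 when f x = 0, which is the intended value since 0 < l < 1. *)

definition log_concave_fun :: "('a::real_vector \<Rightarrow> real) \<Rightarrow> bool" where
  "log_concave_fun f \<longleftrightarrow> (\<forall>x. 0 \<le> f x) \<and>
     (\<forall>x y l. 0 < l \<and> l < 1 \<longrightarrow>
        f (l *\<^sub>R x + (1 - l) *\<^sub>R y) \<ge> f x powr l * f y powr (1 - l))"

definition quasi_convex :: "('a::real_vector \<Rightarrow> real) \<Rightarrow> bool" where
  "quasi_convex g \<longleftrightarrow> (\<forall>c. convex {x. g x \<le> c})"

(* The problem of minimising J over those v in D that satisfy the constraint C. *)

definition convex_problem :: "'v::real_vector set \<Rightarrow> ('v \<Rightarrow> real) \<Rightarrow> ('v \<Rightarrow> bool) \<Rightarrow> bool" where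
  "convex_problem D J C \<longleftrightarrow> convex_on D J \<and> convex {v \<in> D. C v}"

end

theory Submission
  imports Defs
begin

text \<open>
  The probability that \<open>(d, X)\<close> lies in a set \<open>K\<close> is the integral over \<open>v\<close> of \<open>f v * indicator K (d, v)\<close>,
  where \<open>f\<close> is the density of \<open>X\<close>. If \<open>f\<close> is log-concave and \<open>K\<close> is convex, this integrand is log-concave
  jointly in \<open>(d, v)\<close>, so the integral is log-concave in \<open>d\<close>: this is Prekopa's theorem, and it is the
  Prekopa--Leindler inequality (\<open>prekopa_leindler\<close>) applied to three slices of the integrand. A log-concave
  function has convex superlevel sets, whence \<open>convex_chance_constraint\<close>. For the control problem,
  \<open>K\<close> is the intersection of the zero sublevel sets of the \<open>g i\<close>, which is convex by quasi-convexity.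
  The cost is convex because the feedback gain is the same for all decisions, so that for each realisation of the
  disturbance the trajectory is an affine function of the decision variable.

  The Prekopa--Leindler inequality is an integrated Brunn--Minkowski inequality. On the line, a set
  containing \<open>A + B\<close> has measure at least \<open>|A| + |B|\<close> (\<open>brunn_minkowski_real\<close>). Applied to the
  superlevel sets of \<open>F\<close>, \<open>G\<close>, \<open>H\<close>, taken at heights proportional to the suprema of \<open>F\<close> and \<open>G\<close>
  (or to large reals, if these are infinite), and integrated over the height, it bounds the integral of \<open>H\<close> below by a weighted arithmetic mean, hence by the
  weighted geometric mean. Fubini's theorem and induction on the number of coordinates give the inequality
  in every finite dimension.
\<close>

section \<open>Weighted geometric means of extended nonnegative reals\<close>

text \<open>
  For \<open>0 < l < 1\<close> this expresses \<open>X powr l * Y powr (1 - l) \<le> Z\<close> with the convention that the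
  product vanishes as soon as one factor does, even if the other is infinite. Quantifying over real lower bounds of \<open>X\<close>
  and \<open>Y\<close> gives this meaning to infinite values, which arise as inner integrals in the induction on the dimension,
  and every estimate is then one between real powers.
\<close>

definition geometric_mean_le :: "real \<Rightarrow> ennreal \<Rightarrow> ennreal \<Rightarrow> ennreal \<Rightarrow> bool" where
  "geometric_mean_le l X Y Z \<longleftrightarrow>
     (\<forall>a>0. \<forall>b>0. ennreal a \<le> X \<longrightarrow> ennreal b \<le> Y \<longrightarrow> ennreal (a powr l * b powr (1 - l)) \<le> Z)"

lemma powr_convex_scale:
  fixes s a b l :: real
  assumes "0 < s" "0 \<le> a" "0 \<le> b"
  shows "(s * a) powr l * (s * b) powr (1 - l) = s * (a powr l * b powr (1 - l))"
proof -
  have "s powr l * s powr (1 - l) = s"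
    using assms(1) by (simp flip: powr_add)
  then show ?thesis
    using assms by (simp add: powr_mult algebra_simps)
qed

text \<open>
  The geometric mean is homogeneous of degree one, so non-strict bounds follow from strict ones by
  scaling with factors tending to one from below. Strict bounds are what an integral yields when it is
  approximated from below by integrals of truncations.
\<close>

lemma geometric_mean_le_strictI:
  assumes "\<And>a b. 0 < a \<Longrightarrow> 0 < b \<Longrightarrow> ennreal a < X \<Longrightarrow> ennreal b < Y \<Longrightarrow>
      ennreal (a powr l * b powr (1 - l)) \<le> Z"
  shows "geometric_mean_le l X Y Z"
  unfolding geometric_mean_le_def
proof (intro allI impI)
  fix a b :: real
  assume ab: "0 < a" "0 < b" and X: "ennreal a \<le> X" and Y: "ennreal b \<le> Y"
  have scaled: "ennreal (s * (a powr l * b powr (1 - l))) \<le> Z" if s: "0 < s" "s < 1" for s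
  proof -
    have "ennreal (s * a) < ennreal a" "ennreal (s * b) < ennreal b"
      using ab s by (auto intro!: ennreal_lessI)
    then have "ennreal ((s * a) powr l * (s * b) powr (1 - l)) \<le> Z"
      using ab s X Y by (intro assms) (auto intro: order_less_le_trans)
    then show ?thesis
      using powr_convex_scale[of s a b l] ab s by simp
  qed
  show "ennreal (a powr l * b powr (1 - l)) \<le> Z"
  proof (cases Z)
    case (real z)
    have "a powr l * b powr (1 - l) \<le> z"
    proof (rule field_le_mult_one_interval)
      fix s :: real
      assume "0 < s" "s < 1"
      then show "s * (a powr l * b powr (1 - l)) \<le> z"
        using scaled[of s] real by simp
    qed
    then show ?thesis
      using real by (auto intro: ennreal_leI)
  qed simp
qed

section \<open>The Brunn--Minkowski inequality on the line\<close>

text \<open>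
  Cutting \<open>A\<close> strictly below points of \<open>A\<close> itself exhausts \<open>A\<close> up to a possible maximum. Cutting at
  points of \<open>A\<close> is what lets the two translated pieces in \<open>brunn_minkowski_real\<close> stay inside \<open>A + B\<close>.
\<close>

lemma emeasure_lborel_le_SUP_lessThan:
  fixes A :: "real set"
  assumes [measurable]: "A \<in> sets borel" and "A \<noteq> {}"
  shows "emeasure lborel A \<le> (SUP a\<in>A. emeasure lborel (A \<inter> {..<a}))"
proof -
  \<comment> \<open>The thresholds \<open>t\<close> increase to the supremum of \<open>A\<close>, or to infinity. The point \<open>c\<close> is
    a possible maximum of \<open>A\<close>; in the unbounded case it is an arbitrary point.\<close>
  obtain t :: "nat \<Rightarrow> real" and c where t: "incseq t" "\<And>n. \<exists>a\<in>A. t n \<le> a"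
    and cover: "A - {c} \<subseteq> (\<Union>n. A \<inter> {..<t n})"
  proof (cases "bdd_above A")
    case True
    let ?t = "\<lambda>n. Sup A - 1 / real (Suc n)"
    show ?thesis
    proof (rule that[of ?t "Sup A"])
      show "incseq ?t"
        by (intro incseq_SucI) (simp add: field_simps)
      show "\<exists>a\<in>A. ?t n \<le> a" for n
      proof -
        have "\<exists>a\<in>A. ?t n < a"
          using less_cSup_iff[OF \<open>A \<noteq> {}\<close> True, of "?t n"] by simp
        then show ?thesis by (auto intro: less_imp_le)
      qed
      show "A - {Sup A} \<subseteq> (\<Union>n. A \<inter> {..<?t n})"
      proof
        fix x assume x: "x \<in> A - {Sup A}"
        then have "x < Sup A"
          using cSup_upper[of x A] True by (simp add: less_le)
        then obtain n where "1 / real (Suc n) < Sup A - x"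
          using nat_approx_posE[of "Sup A - x"] by auto
        then show "x \<in> (\<Union>n. A \<inter> {..<?t n})"
          using x by (intro UN_I[of n]) auto
      qed
    qed
  next
    case False
    show ?thesis
    proof (rule that[of real 0])
      show "incseq real" by (simp add: incseq_def)
      show "\<exists>a\<in>A. real n \<le> a" for n
        using False by (meson bdd_above.I linorder_le_cases)
      show "A - {0} \<subseteq> (\<Union>n. A \<inter> {..<real n})"
        using reals_Archimedean2 by auto
    qed
  qed
  have "emeasure lborel A = emeasure lborel (A - {c})"
    by (intro emeasure_Diff_null_set[symmetric]) auto
  also have "\<dots> \<le> emeasure lborel (\<Union>n. A \<inter> {..<t n})"
    using cover by (intro emeasure_mono) auto
  also have "\<dots> = (SUP n. emeasure lborel (A \<inter> {..<t n}))"
  proof (intro SUP_emeasure_incseq[symmetric])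
    show "incseq (\<lambda>n. A \<inter> {..<t n})"
      using t(1) by (intro incseq_SucI) (auto dest: incseq_SucD intro: less_le_trans)
  qed auto
  also have "\<dots> \<le> (SUP a\<in>A. emeasure lborel (A \<inter> {..<a}))"
  proof (rule SUP_least)
    fix n
    obtain a where "a \<in> A" "t n \<le> a" using t(2) by blast
    then show "emeasure lborel (A \<inter> {..<t n}) \<le> (SUP a\<in>A. emeasure lborel (A \<inter> {..<a}))"
      by (intro SUP_upper2[of a]) (auto intro!: emeasure_mono)
  qed
  finally show ?thesis .
qed

lemma emeasure_lborel_reflect:
  fixes A :: "real set"
  assumes [measurable]: "A \<in> sets borel"
  shows "emeasure lborel (uminus -` A) = emeasure lborel A"
proof -
  have "emeasure lborel A = emeasure (distr lborel borel uminus) A"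
    by (simp add: lborel_distr_uminus)
  also have "\<dots> = emeasure lborel (uminus -` A)"
    by (subst emeasure_distr) auto
  finally show ?thesis by simp
qed

lemma emeasure_lborel_translate:
  fixes A :: "real set"
  assumes [measurable]: "A \<in> sets borel"
  shows "emeasure lborel ((+) c -` A) = emeasure lborel A"
proof -
  have "emeasure lborel A = emeasure (distr lborel borel ((+) c)) A"
    by (simp add: lborel_distr_plus)
  also have "\<dots> = emeasure lborel ((+) c -` A)"
    by (subst emeasure_distr) auto
  finally show ?thesis by simp
qed

lemma emeasure_lborel_dilate:
  fixes A :: "real set"
  assumes [measurable]: "A \<in> sets borel" and "0 < l"
  shows "emeasure lborel ((\<lambda>x. x / l) -` A) = ennreal l * emeasure lborel A"
proof -
  have [measurable]: "(\<lambda>x. x / l) -` A \<in> sets borel"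
    using measurable_sets[of "\<lambda>x. x / l" borel borel A] by simp
  have "emeasure lborel ((\<lambda>x. x / l) -` A) = (\<integral>\<^sup>+x. indicator ((\<lambda>x. x / l) -` A) x \<partial>lborel)"
    by simp
  also have "\<dots> = ennreal l * (\<integral>\<^sup>+x. indicator ((\<lambda>x. x / l) -` A) (0 + l * x) \<partial>lborel)"
    using \<open>0 < l\<close> by (subst nn_integral_real_affine[where c=l and t=0]) auto
  also have "(\<lambda>x. indicator ((\<lambda>x. x / l) -` A) (0 + l * x)) = (indicator A :: real \<Rightarrow> ennreal)"
    using \<open>0 < l\<close> by (auto simp: indicator_def)
  finally show ?thesis by simp
qed

lemma emeasure_lborel_le_SUP_greaterThan:
  fixes A :: "real set"
  assumes [measurable]: "A \<in> sets borel" and "A \<noteq> {}"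
  shows "emeasure lborel A \<le> (SUP a\<in>A. emeasure lborel (A \<inter> {a<..}))"
proof -
  let ?A = "uminus -` A"
  have [measurable]: "?A \<in> sets borel"
    using measurable_sets[of "uminus :: real \<Rightarrow> real" borel borel A] by simp
  have "?A \<noteq> {}"
    using \<open>A \<noteq> {}\<close> by (metis all_not_in_conv minus_minus vimageI)
  have "emeasure lborel A = emeasure lborel ?A"
    by (simp add: emeasure_lborel_reflect)
  also have "\<dots> \<le> (SUP a\<in>?A. emeasure lborel (?A \<inter> {..<a}))"
    using \<open>?A \<noteq> {}\<close> by (intro emeasure_lborel_le_SUP_lessThan) auto
  also have "\<dots> \<le> (SUP a\<in>A. emeasure lborel (A \<inter> {a<..}))"
  proof (rule SUP_least)
    fix a assume "a \<in> ?A"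
    have "?A \<inter> {..<a} = uminus -` (A \<inter> {- a<..})" by auto
    then have "emeasure lborel (?A \<inter> {..<a}) = emeasure lborel (A \<inter> {- a<..})"
      using emeasure_lborel_reflect[of "A \<inter> {- a<..}"] by simp
    also have "\<dots> \<le> (SUP a\<in>A. emeasure lborel (A \<inter> {a<..}))"
      using \<open>a \<in> ?A\<close> by (intro SUP_upper) auto
    finally show "emeasure lborel (?A \<inter> {..<a}) \<le> \<dots>" .
  qed
  finally show ?thesis .
qed

text \<open>
  For \<open>a\<close> in \<open>A\<close> and \<open>b\<close> in \<open>B\<close>, the part of \<open>A\<close> below \<open>a\<close> shifted by \<open>b\<close> and the part of \<open>B\<close> above \<open>b\<close>
  shifted by \<open>a\<close> both lie in \<open>A + B\<close>, on different sides of \<open>a + b\<close>. They are therefore disjoint, and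
  taking suprema over \<open>a\<close> and \<open>b\<close> recovers all of \<open>A\<close> and \<open>B\<close>. A Borel superset \<open>C\<close> stands in for
  \<open>A + B\<close>, which may fail to be Borel.
\<close>

lemma brunn_minkowski_real:
  fixes A B C :: "real set"
  assumes [measurable]: "A \<in> sets borel" "B \<in> sets borel" "C \<in> sets borel"
    and "A \<noteq> {}" "B \<noteq> {}"
    and sum: "\<And>a b. a \<in> A \<Longrightarrow> b \<in> B \<Longrightarrow> a + b \<in> C"
  shows "emeasure lborel A + emeasure lborel B \<le> emeasure lborel C"
proof -
  let ?L = "\<lambda>a. emeasure lborel (A \<inter> {..<a})" and ?R = "\<lambda>b. emeasure lborel (B \<inter> {b<..})"
  have parts: "?L a + ?R b \<le> emeasure lborel C" if "a \<in> A" "b \<in> B" for a b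
  proof -
    let ?S = "(+) (- b) -` (A \<inter> {..<a})" and ?T = "(+) (- a) -` (B \<inter> {b<..})"
    have meas: "?S \<in> sets borel" "?T \<in> sets borel"
      using measurable_sets[of "(+) (- b)" borel borel "A \<inter> {..<a}"]
        measurable_sets[of "(+) (- a)" borel borel "B \<inter> {b<..}"] by auto
    have "?L a + ?R b = emeasure lborel ?S + emeasure lborel ?T"
      by (simp only: emeasure_lborel_translate[of "A \<inter> {..<a}"] emeasure_lborel_translate[of "B \<inter> {b<..}"]
          assms sets.Int borel_open open_lessThan open_greaterThan)
    also have "\<dots> = emeasure lborel (?S \<union> ?T)"
      using meas by (intro plus_emeasure) auto
    also have "\<dots> \<le> emeasure lborel C"
    proof (intro emeasure_mono)
      show "?S \<union> ?T \<subseteq> C"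
        using sum[OF _ \<open>b \<in> B\<close>] sum[OF \<open>a \<in> A\<close>] by fastforce
    qed simp
    finally show ?thesis .
  qed
  have "emeasure lborel A + emeasure lborel B \<le> (SUP a\<in>A. ?L a) + (SUP b\<in>B. ?R b)"
    using assms by (intro add_mono emeasure_lborel_le_SUP_lessThan emeasure_lborel_le_SUP_greaterThan)
  also have "\<dots> = (SUP b\<in>B. SUP a\<in>A. ?L a + ?R b)"
    using assms by (simp add: ennreal_SUP_add_left ennreal_SUP_add_right)
  also have "\<dots> \<le> emeasure lborel C"
    using parts by (intro SUP_least)
  finally show ?thesis .
qed

section \<open>The Prekopa--Leindler inequality\<close>

text \<open>
  The layer-cake formula for the truncation of \<open>F\<close> at \<open>S\<close>, with heights measured as fractions of \<open>S\<close> so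
  that functions truncated at different heights are integrated over the same interval.
\<close>

lemma nn_integral_min_layer_cake:
  fixes F :: "real \<Rightarrow> ennreal"
  assumes [measurable]: "F \<in> borel_measurable borel" and S: "0 < S"
  shows "(\<integral>\<^sup>+x. min (F x) (ennreal S) \<partial>lborel) =
    ennreal S * (\<integral>\<^sup>+u. indicator {0<..<1} u * emeasure lborel {x. ennreal (S * u) \<le> F x} \<partial>lborel)"
proof -
  have height: "min y (ennreal S) =
      ennreal S * (\<integral>\<^sup>+u. indicator {0<..<1} u * indicator {u. ennreal (S * u) \<le> y} u \<partial>lborel)" for y
  proof -
    define m where "m = enn2real (min y (ennreal S))"
    have m: "ennreal m = min y (ennreal S)"
      unfolding m_def by (simp add: min_less_iff_disj)
    have m0: "0 \<le> m" "m \<le> S"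
      using S by (auto simp: m_def intro: enn2real_leI)
    have "(\<integral>\<^sup>+u. indicator {0<..<1} u * indicator {u. ennreal (S * u) \<le> y} u \<partial>lborel)
        = (\<integral>\<^sup>+u. indicator {0<..m / S} u \<partial>lborel)"
      \<comment> \<open>The two sets of heights can differ only at \<open>u = 1\<close>, when \<open>m = S\<close>.\<close>
    proof (intro nn_integral_cong_AE, use AE_lborel_singleton[of 1] in eventually_elim)
      fix u :: real assume "u \<noteq> 1"
      have "ennreal (S * u) \<le> y \<longleftrightarrow> S * u \<le> m" if "0 < u" "u < 1"
      proof -
        have "ennreal (S * u) \<le> ennreal S" using S that by (intro ennreal_leI) auto
        then have "ennreal (S * u) \<le> y \<longleftrightarrow> ennreal (S * u) \<le> ennreal m" by (simp add: m)
        then show ?thesis using m0 by (simp add: ennreal_le_iff)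
      qed
      moreover have "u < 1" if "u \<le> m / S"
        using that \<open>u \<noteq> 1\<close> m0 S by (smt (verit) divide_le_eq_1_pos)
      ultimately show "indicator {0<..<1} u * indicator {u. ennreal (S * u) \<le> y} u
          = (indicator {0<..m / S} u :: ennreal)"
        using S by (auto simp: indicator_def field_simps)
    qed
    also have "\<dots> = ennreal (m / S)"
      using m0 S by simp
    finally show ?thesis
      using m0 S by (simp flip: ennreal_mult add: m)
  qed
  have [measurable]: "Measurable.pred (borel \<Otimes>\<^sub>M borel) (\<lambda>(u, x). ennreal (S * u) \<le> F x)"
    by measurable
  have "(\<integral>\<^sup>+x. min (F x) (ennreal S) \<partial>lborel) = ennreal S *
      (\<integral>\<^sup>+x. \<integral>\<^sup>+u. indicator {0<..<1} u * indicator {u. ennreal (S * u) \<le> F x} u \<partial>lborel \<partial>lborel)"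
    by (subst height, subst nn_integral_cmult) (auto simp: indicator_def[abs_def])
  also have "(\<integral>\<^sup>+x. \<integral>\<^sup>+u. indicator {0<..<1} u * indicator {u. ennreal (S * u) \<le> F x} u \<partial>lborel \<partial>lborel)
      = (\<integral>\<^sup>+u. \<integral>\<^sup>+x. indicator {0<..<1} u * indicator {u. ennreal (S * u) \<le> F x} u \<partial>lborel \<partial>lborel)"
    by (intro lborel_pair.Fubini') (auto simp: indicator_def[abs_def])
  also have "\<dots> = (\<integral>\<^sup>+u. indicator {0<..<1} u * emeasure lborel {x. ennreal (S * u) \<le> F x} \<partial>lborel)"
  proof (intro nn_integral_cong)
    fix u :: real
    have "(\<integral>\<^sup>+x. indicator {u. ennreal (S * u) \<le> F x} u \<partial>lborel)
        = (\<integral>\<^sup>+x. indicator {x. ennreal (S * u) \<le> F x} x \<partial>lborel)"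
      by (intro nn_integral_cong) (auto simp: indicator_def)
    then show "(\<integral>\<^sup>+x. indicator {0<..<1} u * indicator {u. ennreal (S * u) \<le> F x} u \<partial>lborel)
        = indicator {0<..<1} u * emeasure lborel {x. ennreal (S * u) \<le> F x}"
      by (cases "u \<in> {0<..<1}") simp_all
  qed
  finally show ?thesis .
qed

text \<open>
  By monotone convergence, truncations of \<open>F\<close> have integrals above any value below the integral of \<open>F\<close>.
  Since the height \<open>S\<close> does not exceed the supremum of \<open>F\<close>, every superlevel set of \<open>F\<close> at a
  height below \<open>S\<close> is nonempty, as
  \<open>brunn_minkowski_real\<close> demands.
\<close>

lemma less_nn_integral_min_SUP:
  fixes F :: "real \<Rightarrow> ennreal"
  assumes [measurable]: "F \<in> borel_measurable borel" and a: "a < (\<integral>\<^sup>+x. F x \<partial>lborel)"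
  obtains S where "0 < S" "ennreal S \<le> (SUP x. F x)" "a < (\<integral>\<^sup>+x. min (F x) (ennreal S) \<partial>lborel)"
proof -
  have SUP_min: "(SUP k. min y (of_nat k)) = y" for y :: ennreal
  proof (rule antisym)
    show "y \<le> (SUP k. min y (of_nat k))"
    proof (rule dense_le)
      fix z assume z: "z < y"
      then obtain k where "z < of_nat k" using ennreal_Ex_less_of_nat[of z] by (metis less_le_trans top_greatest)
      then show "z \<le> (SUP k. min y (of_nat k))"
        using z by (intro SUP_upper2[of k]) auto
    qed
  qed (auto intro: SUP_least)
  have "(\<integral>\<^sup>+x. F x \<partial>lborel) = (\<integral>\<^sup>+x. (SUP k. min (F x) (of_nat k)) \<partial>lborel)"
    by (simp add: SUP_min)
  also have "\<dots> = (SUP k. \<integral>\<^sup>+x. min (F x) (of_nat k) \<partial>lborel)"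
    by (intro nn_integral_monotone_convergence_SUP)
      (auto simp: incseq_def le_fun_def intro: min.coboundedI2)
  finally obtain k where k: "a < (\<integral>\<^sup>+x. min (F x) (of_nat k) \<partial>lborel)"
    using a by (auto simp: less_SUP_iff)
  define S where "S = enn2real (min (SUP x. F x) (of_nat k))"
  have S: "ennreal S = min (SUP x. F x) (of_nat k)"
    unfolding S_def by (simp add: min_less_iff_disj of_nat_less_top)
  have cap: "min (F x) (of_nat k) = min (F x) (ennreal S)" for x
    using SUP_upper[of x UNIV F] by (simp add: S min.absorb1 flip: min.assoc)
  show ?thesis
  proof (rule that)
    show "a < (\<integral>\<^sup>+x. min (F x) (ennreal S) \<partial>lborel)"
      using k by (simp add: cap)
    then have "ennreal S \<noteq> 0" by auto
    then show "0 < S" by (metis ennreal_eq_0_iff not_less)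
  qed (simp add: S)
qed

text \<open>
  If \<open>F x\<close> is at least the fraction \<open>u\<close> of \<open>S\<close> and \<open>G y\<close> at least the fraction \<open>u\<close> of \<open>T\<close>, then
  \<open>H\<close> at the weighted mean of \<open>x\<close> and \<open>y\<close> is at least the fraction \<open>u\<close> of \<open>K\<close>, the weighted geometric mean of
  \<open>S\<close> and \<open>T\<close>. Hence the superlevel sets satisfy the Brunn--Minkowski hypothesis for each \<open>u\<close>, and
  integrating over \<open>u\<close> bounds the integral of \<open>H\<close> by \<open>K\<close> times an arithmetic mean of the integrals of \<open>F\<close>
  and \<open>G\<close> in units of \<open>S\<close> and \<open>T\<close>. The inequality of arithmetic and geometric means makes the units cancel.
\<close>

lemma prekopa_leindler_real:
  fixes F G H :: "real \<Rightarrow> ennreal"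
  assumes [measurable]: "F \<in> borel_measurable borel" "G \<in> borel_measurable borel" "H \<in> borel_measurable borel"
    and l: "0 < l" "l < 1"
    and FGH: "\<And>x y. geometric_mean_le l (F x) (G y) (H (l * x + (1 - l) * y))"
  shows "geometric_mean_le l (\<integral>\<^sup>+x. F x \<partial>lborel) (\<integral>\<^sup>+x. G x \<partial>lborel) (\<integral>\<^sup>+x. H x \<partial>lborel)"
proof (rule geometric_mean_le_strictI)
  fix a b :: real
  assume ab: "0 < a" "0 < b"
    and aF: "ennreal a < (\<integral>\<^sup>+x. F x \<partial>lborel)" and bG: "ennreal b < (\<integral>\<^sup>+x. G x \<partial>lborel)"
  obtain S where S: "0 < S" "ennreal S \<le> (SUP x. F x)"
    and aS: "ennreal a < (\<integral>\<^sup>+x. min (F x) (ennreal S) \<partial>lborel)"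
    using less_nn_integral_min_SUP[OF assms(1) aF] .
  obtain T where T: "0 < T" "ennreal T \<le> (SUP x. G x)"
    and bT: "ennreal b < (\<integral>\<^sup>+x. min (G x) (ennreal T) \<partial>lborel)"
    using less_nn_integral_min_SUP[OF assms(2) bG] .
  note ST = S(1) T(1) and sup = S(2) T(2)
  define K where "K = S powr l * T powr (1 - l)"
  have K: "0 < K" using ST by (simp add: K_def)
  let ?f = "\<lambda>u. emeasure lborel {x. ennreal (S * u) \<le> F x}"
    and ?g = "\<lambda>u. emeasure lborel {x. ennreal (T * u) \<le> G x}"
    and ?h = "\<lambda>u. emeasure lborel {x. ennreal (K * u) \<le> H x}"
  have level: "ennreal l * ?f u + ennreal (1 - l) * ?g u \<le> ?h u" if u: "0 < u" "u < 1" for u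
  proof -
    let ?A = "(\<lambda>x. x / l) -` {x. ennreal (S * u) \<le> F x}"
      and ?B = "(\<lambda>x. x / (1 - l)) -` {x. ennreal (T * u) \<le> G x}"
    have "ennreal (S * u) < ennreal S" "ennreal (T * u) < ennreal T"
      using ST u by (auto intro!: ennreal_lessI)
    then have "ennreal (S * u) < (SUP x. F x)" "ennreal (T * u) < (SUP x. G x)"
      using sup by (auto intro: order_less_le_trans)
    then obtain x y where xy: "ennreal (S * u) < F x" "ennreal (T * u) < G y"
      by (auto simp: less_SUP_iff)
    have "emeasure lborel ?A = ennreal l * ?f u" "emeasure lborel ?B = ennreal (1 - l) * ?g u"
      using l by (intro emeasure_lborel_dilate; simp)+
    then have "ennreal l * ?f u + ennreal (1 - l) * ?g u = emeasure lborel ?A + emeasure lborel ?B"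
      by simp
    also have "\<dots> \<le> ?h u"
    proof (rule brunn_minkowski_real)
      show "?A \<in> sets borel" "?B \<in> sets borel" "{x. ennreal (K * u) \<le> H x} \<in> sets borel"
        unfolding vimage_def mem_Collect_eq by measurable
      have "l * x \<in> ?A" "(1 - l) * y \<in> ?B"
        using xy l by auto
      then show "?A \<noteq> {}" "?B \<noteq> {}" by blast+
    next
      fix a b assume "a \<in> ?A" "b \<in> ?B"
      then have "ennreal (u * S) \<le> F (a / l)" "ennreal (u * T) \<le> G (b / (1 - l))"
        by (simp_all add: mult.commute)
      then have "ennreal ((u * S) powr l * (u * T) powr (1 - l)) \<le> H (l * (a / l) + (1 - l) * (b / (1 - l)))"
        using FGH[of "a / l" "b / (1 - l)"] u ST unfolding geometric_mean_le_def by auto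
      moreover have "(u * S) powr l * (u * T) powr (1 - l) = K * u"
        using powr_convex_scale[of u S T l] u ST by (simp add: K_def)
      ultimately show "a + b \<in> {x. ennreal (K * u) \<le> H x}"
        using l by simp
    qed
    finally show ?thesis .
  qed
  have [measurable]: "?f \<in> borel_measurable borel" "?g \<in> borel_measurable borel" "?h \<in> borel_measurable borel"
    by measurable
  let ?I = "\<lambda>\<phi>. \<integral>\<^sup>+u. indicator {0<..<1::real} u * \<phi> u \<partial>lborel"
  have meanS: "ennreal (a / S) \<le> ?I ?f" and meanT: "ennreal (b / T) \<le> ?I ?g"
    using ab ST less_imp_le[OF aS] less_imp_le[OF bT]
    by (simp_all add: nn_integral_min_layer_cake divide_ennreal[symmetric] divide_le_posI_ennreal)
  have "a powr l * b powr (1 - l) = K * ((a / S) powr l * (b / T) powr (1 - l))"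
    using ab ST by (simp add: K_def powr_divide)
  also have "\<dots> \<le> K * (l * (a / S) + (1 - l) * (b / T))"
    using ab ST l K by (intro mult_left_mono Youngs_inequality_0) auto
  finally have "ennreal (a powr l * b powr (1 - l)) \<le> ennreal (K * (l * (a / S) + (1 - l) * (b / T)))"
    by (rule ennreal_leI)
  also have "\<dots> = ennreal K * (ennreal l * ennreal (a / S) + ennreal (1 - l) * ennreal (b / T))"
    using K l ab ST by (simp flip: ennreal_mult ennreal_plus)
  also have "\<dots> \<le> ennreal K * (ennreal l * ?I ?f + ennreal (1 - l) * ?I ?g)"
    by (intro mult_left_mono add_mono meanS meanT) auto
  also have "ennreal l * ?I ?f + ennreal (1 - l) * ?I ?g =
      (\<integral>\<^sup>+u. ennreal l * (indicator {0<..<1} u * ?f u) + ennreal (1 - l) * (indicator {0<..<1} u * ?g u) \<partial>lborel)"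
    by (subst nn_integral_add) (simp_all add: nn_integral_cmult)
  also have "\<dots> = ?I (\<lambda>u. ennreal l * ?f u + ennreal (1 - l) * ?g u)"
    by (intro nn_integral_cong) (simp add: distrib_left mult.left_commute)
  also have "ennreal K * \<dots> \<le> ennreal K * ?I ?h"
    by (intro mult_left_mono[OF nn_integral_mono]) (simp_all add: level split: split_indicator)
  also have "\<dots> = (\<integral>\<^sup>+x. min (H x) (ennreal K) \<partial>lborel)"
    using K by (simp add: nn_integral_min_layer_cake)
  also have "\<dots> \<le> (\<integral>\<^sup>+x. H x \<partial>lborel)"
    by (intro nn_integral_mono) simp
  finally show "ennreal (a powr l * b powr (1 - l)) \<le> (\<integral>\<^sup>+x. H x \<partial>lborel)" .
qed

text \<open>
  Integrating out one coordinate with the inequality on the line shows that the partial integrals of \<open>F\<close>, \<open>G\<close>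
  and \<open>H\<close> satisfy the hypothesis in the remaining coordinates. This closes the induction because hypothesis
  and conclusion are the same relation.
\<close>

lemma prekopa_leindler_PiM:
  fixes F G H :: "('b \<Rightarrow> real) \<Rightarrow> ennreal"
  assumes "finite I" and l: "0 < l" "l < 1"
    and "F \<in> borel_measurable (Pi\<^sub>M I (\<lambda>_. lborel))"
      "G \<in> borel_measurable (Pi\<^sub>M I (\<lambda>_. lborel))"
      "H \<in> borel_measurable (Pi\<^sub>M I (\<lambda>_. lborel))"
    and "\<And>x y. x \<in> extensional I \<Longrightarrow> y \<in> extensional I \<Longrightarrow>
      geometric_mean_le l (F x) (G y) (H (\<lambda>i\<in>I. l * x i + (1 - l) * y i))"
  shows "geometric_mean_le l (\<integral>\<^sup>+x. F x \<partial>Pi\<^sub>M I (\<lambda>_. lborel))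
    (\<integral>\<^sup>+x. G x \<partial>Pi\<^sub>M I (\<lambda>_. lborel)) (\<integral>\<^sup>+x. H x \<partial>Pi\<^sub>M I (\<lambda>_. lborel))"
  using assms(1,4-)
proof (induction I arbitrary: F G H)
  case empty
  \<comment> \<open>The empty product has a single point, so the hypothesis there is already the claim.\<close>
  from empty.prems(4)[of "\<lambda>_. undefined" "\<lambda>_. undefined"] show ?case
    by (simp add: PiM_empty nn_integral_count_space_finite restrict_def)
next
  case (insert i I)
  note [measurable] = insert.prems(1-3)
  interpret product_sigma_finite "\<lambda>_::'b. lborel :: real measure" ..
  let ?slice = "\<lambda>\<Phi> x. \<integral>\<^sup>+t. \<Phi> (x(i := t)) \<partial>lborel"
  have slice_meas: "?slice \<Phi> \<in> borel_measurable (Pi\<^sub>M I (\<lambda>_. lborel))"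
    if [measurable]: "\<Phi> \<in> borel_measurable (Pi\<^sub>M (insert i I) (\<lambda>_. lborel))" for \<Phi> :: "('b \<Rightarrow> real) \<Rightarrow> ennreal"
    by measurable
  have line_meas: "(\<lambda>t. \<Phi> (x(i := t))) \<in> borel_measurable borel"
    if [measurable]: "\<Phi> \<in> borel_measurable (Pi\<^sub>M (insert i I) (\<lambda>_. lborel))"
      and x: "x \<in> extensional I" for \<Phi> :: "('b \<Rightarrow> real) \<Rightarrow> ennreal" and x
  proof -
    have "x \<in> space (Pi\<^sub>M I (\<lambda>_. lborel))"
      using x by (simp add: space_PiM PiE_def)
    then have "(\<lambda>t. x(i := t)) \<in> measurable lborel (Pi\<^sub>M (insert i I) (\<lambda>_. lborel))"
      by (intro measurable_fun_upd[where J=I]) auto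
    then show ?thesis
      by measurable
  qed
  have "geometric_mean_le l (?slice F x) (?slice G y) (?slice H (\<lambda>j\<in>I. l * x j + (1 - l) * y j))"
    if xy: "x \<in> extensional I" "y \<in> extensional I" for x y
  proof (rule prekopa_leindler_real)
    fix s t
    have "x(i := s) \<in> extensional (insert i I)" "y(i := t) \<in> extensional (insert i I)"
      using xy by (auto simp: extensional_def)
    moreover have "(\<lambda>j\<in>insert i I. l * (x(i := s)) j + (1 - l) * (y(i := t)) j)
        = (\<lambda>j\<in>I. l * x j + (1 - l) * y j)(i := l * s + (1 - l) * t)"
      using insert.hyps by (auto simp: fun_eq_iff restrict_def)
    ultimately show "geometric_mean_le l (F (x(i := s))) (G (y(i := t)))
        (H ((\<lambda>j\<in>I. l * x j + (1 - l) * y j)(i := l * s + (1 - l) * t)))"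
      using insert.prems(4) by metis
  qed (use xy l line_meas insert.prems in auto)
  then have "geometric_mean_le l (\<integral>\<^sup>+x. ?slice F x \<partial>Pi\<^sub>M I (\<lambda>_. lborel))
      (\<integral>\<^sup>+x. ?slice G x \<partial>Pi\<^sub>M I (\<lambda>_. lborel)) (\<integral>\<^sup>+x. ?slice H x \<partial>Pi\<^sub>M I (\<lambda>_. lborel))"
    by (intro insert.IH slice_meas insert.prems)
  then show ?case
    using insert.hyps insert.prems by (simp add: product_nn_integral_insert)
qed

theorem prekopa_leindler:
  fixes F G H :: "'b::euclidean_space \<Rightarrow> ennreal"
  assumes [measurable]: "F \<in> borel_measurable borel" "G \<in> borel_measurable borel" "H \<in> borel_measurable borel"
    and l: "0 < l" "l < 1"
    and FGH: "\<And>x y. geometric_mean_le l (F x) (G y) (H (l *\<^sub>R x + (1 - l) *\<^sub>R y))"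
  shows "geometric_mean_le l (\<integral>\<^sup>+x. F x \<partial>lborel) (\<integral>\<^sup>+x. G x \<partial>lborel) (\<integral>\<^sup>+x. H x \<partial>lborel)"
proof -
  let ?P = "Pi\<^sub>M (Basis :: 'b set) (\<lambda>_. lborel :: real measure)"
  let ?vec = "\<lambda>x. \<Sum>b\<in>Basis. x b *\<^sub>R b :: 'b"
  have [measurable]: "?vec \<in> measurable ?P borel"
    by measurable
  have coords: "(\<integral>\<^sup>+x. \<Phi> x \<partial>lborel) = (\<integral>\<^sup>+x. \<Phi> (?vec x) \<partial>?P)"
    if [measurable]: "\<Phi> \<in> borel_measurable borel" for \<Phi> :: "'b \<Rightarrow> ennreal"
    by (subst lborel_eq, subst nn_integral_distr) auto
  have "geometric_mean_le l (\<integral>\<^sup>+x. F (?vec x) \<partial>?P) (\<integral>\<^sup>+x. G (?vec x) \<partial>?P) (\<integral>\<^sup>+x. H (?vec x) \<partial>?P)"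
  proof (rule prekopa_leindler_PiM)
    fix x y :: "'b \<Rightarrow> real"
    have "?vec (\<lambda>b\<in>Basis. l * x b + (1 - l) * y b) = l *\<^sub>R ?vec x + (1 - l) *\<^sub>R ?vec y"
      by (simp add: scaleR_sum_right sum.distrib scaleR_add_left)
    then show "geometric_mean_le l (F (?vec x)) (G (?vec y))
        (H (?vec (\<lambda>b\<in>Basis. l * x b + (1 - l) * y b)))"
      using FGH by simp
  qed (use l in simp_all)
  then show ?thesis
    by (simp add: coords)
qed


section \<open>Chance constraints under log-concave densities\<close>

text \<open>
  Restricting a log-concave function to slices of a convex set keeps the hypothesis of Prekopa--Leindler: where
  both restricted values are positive, the mean point lies in the third slice, and elsewhere the
  claim is void.
\<close>

lemma geometric_mean_le_log_concave:
  assumes f: "log_concave_fun f" and l: "0 < l" "l < 1"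
    and C: "x \<in> C1 \<Longrightarrow> y \<in> C2 \<Longrightarrow> l *\<^sub>R x + (1 - l) *\<^sub>R y \<in> C"
  shows "geometric_mean_le l (ennreal (f x) * indicator C1 x) (ennreal (f y) * indicator C2 y)
    (ennreal (f (l *\<^sub>R x + (1 - l) *\<^sub>R y)) * indicator C (l *\<^sub>R x + (1 - l) *\<^sub>R y))"
  unfolding geometric_mean_le_def
proof (intro allI impI)
  fix a b :: real
  assume ab: "0 < a" "0 < b"
    and a: "ennreal a \<le> ennreal (f x) * indicator C1 x"
    and b: "ennreal b \<le> ennreal (f y) * indicator C2 y"
  have xy: "x \<in> C1" "y \<in> C2"
    using a b ab by (auto split: split_indicator_asm)
  have nonneg: "0 \<le> f z" for z
    using f by (simp add: log_concave_fun_def)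
  have "a \<le> f x" "b \<le> f y"
    using a b xy nonneg by simp_all
  then have "a powr l * b powr (1 - l) \<le> f x powr l * f y powr (1 - l)"
    using ab l by (intro mult_mono powr_mono2) auto
  also have "\<dots> \<le> f (l *\<^sub>R x + (1 - l) *\<^sub>R y)"
    using f l by (simp add: log_concave_fun_def)
  finally show "ennreal (a powr l * b powr (1 - l)) \<le>
      ennreal (f (l *\<^sub>R x + (1 - l) *\<^sub>R y)) * indicator C (l *\<^sub>R x + (1 - l) *\<^sub>R y)"
    using C[OF xy] by (simp add: ennreal_leI)
qed

text \<open>
  Prekopa's theorem, in the form needed for level sets: if the integrals over the sections at \<open>x\<close> and
  \<open>y\<close> are both at least \<open>c\<close>, the integral over the section at the mean of \<open>x\<close> and \<open>y\<close> with weights \<open>u\<close> and \<open>1 - u\<close> is at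
  least \<open>c powr u * c powr (1 - u)\<close>, which is \<open>c\<close>.
\<close>

theorem convex_chance_constraint:
  fixes X :: "'a \<Rightarrow> 'w::euclidean_space" and K :: "('d::real_vector \<times> 'w) set"
  assumes "prob_space M" and X: "distributed M lborel X (\<lambda>v. ennreal (f v))" and f: "log_concave_fun f"
    and K: "convex K" and sections: "\<And>d. {v. (d, v) \<in> K} \<in> sets borel" and "0 < c"
  shows "convex {d. c \<le> measure M {\<omega> \<in> space M. (d, X \<omega>) \<in> K}}"
proof (rule convexI)
  interpret prob_space M by fact
  have [measurable]: "(\<lambda>v. ennreal (f v)) \<in> borel_measurable borel"
    using distributed_borel_measurable[OF X] by simp
  have prob_eq: "ennreal (measure M {\<omega> \<in> space M. (d, X \<omega>) \<in> K}) =
      (\<integral>\<^sup>+v. ennreal (f v) * indicator {v. (d, v) \<in> K} v \<partial>lborel)" for d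
  proof -
    have "{\<omega> \<in> space M. (d, X \<omega>) \<in> K} = X -` {v. (d, v) \<in> K} \<inter> space M"
      by auto
    then show ?thesis
      using distributed_emeasure[OF X, of "{v. (d, v) \<in> K}"] sections by (simp flip: emeasure_eq_measure)
  qed
  fix x y and u v :: real
  assume x: "x \<in> {d. c \<le> measure M {\<omega> \<in> space M. (d, X \<omega>) \<in> K}}"
    and y: "y \<in> {d. c \<le> measure M {\<omega> \<in> space M. (d, X \<omega>) \<in> K}}"
    and uv: "0 \<le> u" "0 \<le> v" "u + v = 1"
  show "u *\<^sub>R x + v *\<^sub>R y \<in> {d. c \<le> measure M {\<omega> \<in> space M. (d, X \<omega>) \<in> K}}"
  proof (cases "u = 0 \<or> u = 1")
    case True
    then show ?thesis using x y uv by auto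
  next
    case False
    then have u: "0 < u" "u < 1" and v: "v = 1 - u"
      using uv by auto
    let ?z = "u *\<^sub>R x + v *\<^sub>R y"
    let ?I = "\<lambda>d. \<integral>\<^sup>+v. ennreal (f v) * indicator {v. (d, v) \<in> K} v \<partial>lborel"
    note [measurable] = sections
    have "geometric_mean_le u (?I x) (?I y) (?I ?z)"
    proof (rule prekopa_leindler[OF _ _ _ u])
      fix s t :: 'w
      have "u *\<^sub>R s + (1 - u) *\<^sub>R t \<in> {v. (?z, v) \<in> K}"
        if "s \<in> {v. (x, v) \<in> K}" "t \<in> {v. (y, v) \<in> K}"
        using convexD[OF K, of "(x, s)" "(y, t)" u v] that uv v by simp
      then show "geometric_mean_le u (ennreal (f s) * indicator {v. (x, v) \<in> K} s)
          (ennreal (f t) * indicator {v. (y, v) \<in> K} t)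
          (ennreal (f (u *\<^sub>R s + (1 - u) *\<^sub>R t)) * indicator {v. (?z, v) \<in> K} (u *\<^sub>R s + (1 - u) *\<^sub>R t))"
        using u by (intro geometric_mean_le_log_concave f)
    qed auto
    moreover have "ennreal c \<le> ?I x" "ennreal c \<le> ?I y"
      using x y by (simp_all add: ennreal_leI flip: prob_eq)
    ultimately have "ennreal (c powr u * c powr (1 - u)) \<le> ?I ?z"
      using \<open>0 < c\<close> unfolding geometric_mean_le_def by blast
    then show ?thesis
      using \<open>0 < c\<close> by (simp flip: prob_eq powr_add)
  qed
qed

section \<open>Convexity of the control problem\<close>

lemma convex_on_integral:
  fixes \<phi> :: "'v::real_vector \<Rightarrow> 'a \<Rightarrow> real"
  assumes "convex D" and conv: "\<And>\<omega>. convex_on D (\<lambda>\<theta>. \<phi> \<theta> \<omega>)"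
    and int: "\<And>\<theta>. \<theta> \<in> D \<Longrightarrow> integrable M (\<phi> \<theta>)"
  shows "convex_on D (\<lambda>\<theta>. \<integral>\<omega>. \<phi> \<theta> \<omega> \<partial>M)"
proof (rule convex_onI)
  fix t :: real and x y
  assume t: "0 < t" "t < 1" and xy: "x \<in> D" "y \<in> D"
  have "(1 - t) *\<^sub>R x + t *\<^sub>R y \<in> D"
    using \<open>convex D\<close> t xy by (simp add: convexD)
  then have "(\<integral>\<omega>. \<phi> ((1 - t) *\<^sub>R x + t *\<^sub>R y) \<omega> \<partial>M) \<le> (\<integral>\<omega>. (1 - t) * \<phi> x \<omega> + t * \<phi> y \<omega> \<partial>M)"
    using t xy convex_onD[OF conv] by (intro integral_mono) (auto intro!: int)
  also have "\<dots> = (1 - t) * (\<integral>\<omega>. \<phi> x \<omega> \<partial>M) + t * (\<integral>\<omega>. \<phi> y \<omega> \<partial>M)"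
    using xy int by simp
  finally show "(\<integral>\<omega>. \<phi> ((1 - t) *\<^sub>R x + t *\<^sub>R y) \<omega> \<partial>M) \<le> \<dots>" .
qed fact

lemma input_traj_linear:
  "input_traj (u *\<^sub>R \<theta> + v *\<^sub>R \<theta>') w = u *\<^sub>R input_traj \<theta> w + v *\<^sub>R input_traj \<theta>' w"
  by (simp add: input_traj_def matrix_vector_mult_add_rdistrib scaleR_add_right
      flip: scaleR_matrix_vector_assoc)

lemma state_traj_eq:
  "state_traj A B x0 \<theta> w = A_bar A *v x0 + B_bar A B *v input_traj \<theta> w + D_bar A *v w"
  by (simp add: state_traj_def input_traj_def)

text \<open>
  The state depends on the decision only through the input, which is linear in it. The free response to
  the initial state and to the disturbance is a constant term, which only weights summing to one preserve.
\<close>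

lemma state_traj_affine:
  assumes "u + v = 1"
  shows "state_traj A B x0 (u *\<^sub>R \<theta> + v *\<^sub>R \<theta>') w = u *\<^sub>R state_traj A B x0 \<theta> w + v *\<^sub>R state_traj A B x0 \<theta>' w"
proof -
  have split: "z = u *\<^sub>R z + v *\<^sub>R z" for z :: "'z::real_vector"
    using assms by (simp flip: scaleR_add_left)
  show ?thesis
    unfolding state_traj_eq input_traj_linear
    by (subst split[of "A_bar A *v x0"], subst split[of "D_bar A *v w"])
      (simp add: matrix_vector_right_distrib matrix_vector_mult_scaleR scaleR_add_right)
qed

lemma convex_on_trajectory_cost:
  assumes V: "convex_on UNIV V" and "convex D"
  shows "convex_on D (\<lambda>\<theta>. V (state_traj A B x0 \<theta> w, input_traj \<theta> w))"
proof (rule convex_onI)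
  fix t :: real and \<theta> \<theta>'
  assume "0 < t" "t < 1"
  have "(state_traj A B x0 ((1 - t) *\<^sub>R \<theta> + t *\<^sub>R \<theta>') w, input_traj ((1 - t) *\<^sub>R \<theta> + t *\<^sub>R \<theta>') w)
      = (1 - t) *\<^sub>R (state_traj A B x0 \<theta> w, input_traj \<theta> w) + t *\<^sub>R (state_traj A B x0 \<theta>' w, input_traj \<theta>' w)"
    by (simp add: state_traj_affine input_traj_linear)
  moreover have "V ((1 - t) *\<^sub>R (state_traj A B x0 \<theta> w, input_traj \<theta> w) + t *\<^sub>R (state_traj A B x0 \<theta>' w, input_traj \<theta>' w))
      \<le> (1 - t) * V (state_traj A B x0 \<theta> w, input_traj \<theta> w) + t * V (state_traj A B x0 \<theta>' w, input_traj \<theta>' w)"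
    using \<open>0 < t\<close> \<open>t < 1\<close> by (intro convex_onD[OF V]) auto
  ultimately show "V (state_traj A B x0 ((1 - t) *\<^sub>R \<theta> + t *\<^sub>R \<theta>') w, input_traj ((1 - t) *\<^sub>R \<theta> + t *\<^sub>R \<theta>') w)
      \<le> (1 - t) * V (state_traj A B x0 \<theta> w, input_traj \<theta> w) + t * V (state_traj A B x0 \<theta>' w, input_traj \<theta>' w)"
    by metis
qed fact

theorem proposition5:
  fixes M :: "'a measure"
    and A :: "real^'n^'n" and B :: "real^'m^'n" and x0 :: "real^'n"
    and w :: "'N::finite stage \<Rightarrow> 'a \<Rightarrow> real^'n"
    and w_bar :: "'a \<Rightarrow> real^('N stage \<times> 'n)"
    and f :: "real^('N stage \<times> 'n) \<Rightarrow> real"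
    and G :: "real^('N stage \<times> 'n)^('N stage \<times> 'm)"
    and r :: nat
    and \<eta> :: "nat \<Rightarrow> (real^('N epoch \<times> 'n)) \<times> (real^('N stage \<times> 'm)) \<Rightarrow> real"
    and g :: "nat \<Rightarrow> (real^('N stage \<times> 'm)) \<times> (real^('N stage \<times> 'n)) \<Rightarrow> real"
    and p :: "real^('N stage \<times> 'm) \<Rightarrow> real"
    and \<Theta> :: "((real^('N stage \<times> 'n)^('N stage \<times> 'm)) \<times> (real^('N stage \<times> 'm))) set"
  assumes "prob_space M"
    and "\<And>t. w t \<in> borel_measurable M"
    and w_bar: "\<And>\<omega>. w_bar \<omega> = stack_vec (\<lambda>t. w t \<omega>)"
    and "strictly_block_lower_triangular G"
    and "r \<ge> 1"
    and "\<And>i. i \<in> {1..r} \<Longrightarrow> \<eta> i \<in> borel_measurable borel"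
    and g: "\<And>i d v. g i (d, v) =
        \<eta> i (A_bar A *v x0 + B_bar A B *v (G *v v + d) + D_bar A *v v, G *v v + d)"
    and "distributed M lborel w_bar (\<lambda>v. ennreal (f v))"
    and "log_concave_fun f"
    and "\<And>i. i \<in> {1..r} \<Longrightarrow> quasi_convex (g i)"
    and p: "\<And>d. p d = measure M {\<omega> \<in> space M. \<forall>i\<in>{1..r}. g i (d, w_bar \<omega>) \<le> 0}"
    and \<Theta>: "\<Theta> = {(G, d) | d. True}"
  shows "(\<forall>\<alpha>\<in>{0<..<1}. convex {d. p d \<ge> 1 - \<alpha>}) \<and>
    (\<forall>V :: (real^('N epoch \<times> 'n)) \<times> (real^('N stage \<times> 'm)) \<Rightarrow> real.
       V \<in> borel_measurable borel \<and> convex_on UNIV V \<and>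
       (\<forall>\<theta>\<in>\<Theta>. integrable M (\<lambda>\<omega>. V (state_traj A B x0 \<theta> (w_bar \<omega>), input_traj \<theta> (w_bar \<omega>)))) \<longrightarrow>
       (\<forall>\<alpha>\<in>{0<..<1}. convex_problem \<Theta>
          (\<lambda>\<theta>. \<integral>\<omega>. V (state_traj A B x0 \<theta> (w_bar \<omega>), input_traj \<theta> (w_bar \<omega>)) \<partial>M)
          (\<lambda>\<theta>. p (snd \<theta>) \<ge> 1 - \<alpha>)))"
proof -
  let ?K = "{dv. \<forall>i\<in>{1..r}. g i dv \<le> 0}"
  have chance: "convex {d. p d \<ge> 1 - \<alpha>}" if "\<alpha> < 1" for \<alpha>
  proof -
    have K: "convex ?K"
    proof -
      have "?K = (\<Inter>i\<in>{1..r}. {dv. g i dv \<le> 0})" by auto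
      then show ?thesis
        using assms(10) by (auto simp: quasi_convex_def intro!: convex_INT)
    qed
    \<comment> \<open>For fixed \<open>d\<close> the trajectory is continuous in the disturbance, so each \<open>g i\<close> inherits
      measurability from \<open>\<eta> i\<close>.\<close>
    have sections: "{v. (d, v) \<in> ?K} \<in> sets borel" for d
    proof -
      have "(\<lambda>v. g i (d, v)) \<in> borel_measurable borel" if "i \<in> {1..r}" for i
        unfolding g
        by (rule measurable_compose[OF borel_measurable_continuous_onI assms(6)[OF that]])
          (intro continuous_intros continuous_on_compose2[OF matrix_vector_mult_linear_continuous_on[of UNIV]]; simp)
      then have "(\<Inter>i\<in>{1..r}. {v. g i (d, v) \<le> 0}) \<in> sets borel"
        using \<open>r \<ge> 1\<close> by (intro sets.finite_INT) auto
      moreover have "{v. (d, v) \<in> ?K} = (\<Inter>i\<in>{1..r}. {v. g i (d, v) \<le> 0})" by auto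
      ultimately show ?thesis by simp
    qed
    show ?thesis
      using convex_chance_constraint[OF assms(1,8,9) K sections, of "1 - \<alpha>"] that
      by (simp add: p)
  qed
  have "convex \<Theta>"
  proof -
    have "\<Theta> = {G} \<times> UNIV" using \<Theta> by auto
    then show ?thesis by (simp add: convex_Times)
  qed
  have feasible: "convex {\<theta> \<in> \<Theta>. p (snd \<theta>) \<ge> 1 - \<alpha>}" if "\<alpha> < 1" for \<alpha>
  proof -
    have "{\<theta> \<in> \<Theta>. p (snd \<theta>) \<ge> 1 - \<alpha>} = {G} \<times> {d. p d \<ge> 1 - \<alpha>}" using \<Theta> by auto
    then show ?thesis using chance[OF that] by (simp add: convex_Times)
  qed
  show ?thesis
    using chance feasible \<open>convex \<Theta>\<close>
    by (auto simp: convex_problem_def intro!: convex_on_integral convex_on_trajectory_cost)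
qed

end
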